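(* For all $k\ge3$, the self-similar set $K^{(k)}\subset\mathbb{R}^{k-1}$ is homeomorphic to the limit space $\mathcal{J}^{(k)}$ of the contracting self-similar group $H_c^{(k)}$.
   Context: Let $\mathsf{X}_k=\{0,\dots,k-1\}$ and let $\mathsf{X}_k^*$ be the set of finite words over $\mathsf{X}_k$, viewed as a rooted tree; $\operatorname{Aut}\mathsf{X}_k^*$ is the group of permutations of $\mathsf{X}_k^*$ preserving word length and common prefixes. For $g\in\operatorname{Aut}\mathsf{X}_k^*$, the root permutation $\sigma_g\in\operatorname{Sym}(\mathsf{X}_k)$ is the restriction of $g$ to one-letter words, and for $x\in\mathsf{X}_k$ the section $g|_x$ is defined by $g(xw)=\sigma_g(x)\,g|_x(w)$ for all $w\in\mathsf{X}_k^*$. Let $S_{k,1}$ be the set of all $a\in\operatorname{Aut}\mathsf{X}_k^*$ for which there is a single peg $j\in\mathsf{X}_k$ such that $a|_j=a$, $\sigma_a(j)=j$, and $a|_i=1$ for all $i\ne j$ (this includes the identity). $H_c^{(k)}$ is the subgroup of $\operatorname{Aut}\mathsf{X}_k^*$ generated by $S_{k,1}$; it is a contracting self-similar group. Limit space: let $\mathsf{X}_k^{-\omega}$ be the set of left-infinite sequences $\ldots x_2x_1$ with $x_i\in\mathsf{X}_k$, with the product topology of discrete spaces. For a contracting group $G\le\operatorname{Aut}\mathsf{X}_k^*$, two sequences $\ldots x_2x_1$ and $\ldots y_2y_1$ are asymptotically equivalent if there is a sequence $(g_n)_{n\ge1}$ in $G$, taking only finitely many values, with $g_n(x_n\ldots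 x_2x_1)=y_n\ldots y_2y_1$ for all $n\ge1$. The limit space of $G$ is the quotient topological space of $\mathsf{X}_k^{-\omega}$ by asymptotic equivalence; $\mathcal{J}^{(k)}$ denotes the limit space of $H_c^{(k)}$. The set $K^{(k)}$: let $p_0,\dots,p_{k-1}$ be the vertices of a regular simplex in $\mathbb{R}^{k-1}$ (with $k$ vertices), and let $q_i=\frac1{k-1}\sum_{j\neq i}p_j$. For $i\in\mathsf{X}_k$ let $F_i:\mathbb{R}^{k-1}\to\mathbb{R}^{k-1}$ be the unique affine map with $F_i(p_i)=p_i$ and $F_i(p_j)=q_j$ for $j\ne i$; each $F_i$ is a contraction for the Euclidean metric. $K^{(k)}$ is the unique nonempty compact set with $K^{(k)}=\bigcup_{i\in\mathsf{X}_k}F_i(K^{(k)})$. *)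

theory Defs
  imports "HOL-Analysis.Analysis" "HOL-Algebra.Generated_Groups"
    "HOL-Combinatorics.Permutations"
begin

section \<open>Automorphisms of the rooted tree of words\<close>

text \<open>Words over the alphabet \<open>{0,\<dots>,k-1}\<close> are lists; the head of the list is the first letter.\<close>

abbreviation words :: "nat \<Rightarrow> nat list set"
  where "words k \<equiv> lists {..<k}"

text \<open>By definition of \<^const>\<open>permutes\<close>, an automorphism is extended by the identity to lists that
  are not words over the alphabet, so that equality of automorphisms is equality of functions. The
  sections defined below respect this convention.\<close>

definition tree_aut :: "nat \<Rightarrow> (nat list \<Rightarrow> nat list) monoid"
  where "tree_aut k =
    \<lparr> carrier = {g. g permutes words k \<and>
        (\<forall>u \<in> words k. length (g u) = length u) \<and>
        (\<forall>u \<in> words k. \<forall>v \<in> words k. \<forall>n. take n (g u) = take n (g v) \<longleftrightarrow> take n u = take n v)},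
      mult = (\<circ>), one = id \<rparr>"

definition root_perm :: "(nat list \<Rightarrow> nat list) \<Rightarrow> nat \<Rightarrow> nat"
  where "root_perm g x = hd (g [x])"

definition sect :: "(nat list \<Rightarrow> nat list) \<Rightarrow> nat \<Rightarrow> nat list \<Rightarrow> nat list"
  where "sect g x w = tl (g (x # w))"

lemma sect_eq:
  assumes "g \<in> carrier (tree_aut k)" "x < k" "w \<in> words k"
  shows "g (x # w) = root_perm g x # sect g x w"
proof -
  have xs: "[x] \<in> words k" "x # w \<in> words k"
    using assms by auto
  have L: "\<forall>u \<in> words k. length (g u) = length u"
    and T: "\<forall>u \<in> words k. \<forall>v \<in> words k. \<forall>n. take n (g u) = take n (g v) \<longleftrightarrow> take n u = take n v"
    using assms(1) unfolding tree_aut_def by auto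
  have len: "length (g [x]) = Suc 0" "length (g (x # w)) = Suc (length w)"
    using bspec[OF L xs(1)] bspec[OF L xs(2)] by simp_all
  obtain y where y: "g [x] = [y]"
    using len(1) by (auto simp: length_Suc_conv)
  obtain z u where zu: "g (x # w) = z # u"
    using len(2) by (auto simp: length_Suc_conv)
  have "take 1 (g (x # w)) = take 1 (g [x])"
    using bspec[OF bspec[OF T xs(2)] xs(1)] by simp
  then have "z = y"
    using y zu by simp
  then show ?thesis
    using y zu by (simp add: root_perm_def sect_def)
qed

lemma group_tree_aut: "group (tree_aut k)"
proof (rule groupI)
  fix g assume g: "g \<in> carrier (tree_aut k)"
  then have p: "g permutes words k"
    by (simp add: tree_aut_def)
  let ?h = "inv_into UNIV g"
  have hp: "?h permutes words k"
    using p by (rule permutes_inv)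
  have gh: "g (?h u) = u" for u
    using p by (rule permutes_inverses)
  have mem: "?h u \<in> words k" if "u \<in> words k" for u
    using that permutes_in_image[OF hp] by blast
  have len: "\<forall>u \<in> words k. length (g u) = length u"
    and tk: "\<forall>u \<in> words k. \<forall>v \<in> words k. \<forall>n. take n (g u) = take n (g v) \<longleftrightarrow> take n u = take n v"
    using g unfolding tree_aut_def by auto
  have "length (?h u) = length u" if "u \<in> words k" for u
    using bspec[OF len mem[OF that]] gh by simp
  moreover have "take n (?h u) = take n (?h v) \<longleftrightarrow> take n u = take n v"
    if "u \<in> words k" "v \<in> words k" for u v n
    using bspec[OF bspec[OF tk mem[OF that(1)]] mem[OF that(2)]] gh by simp
  ultimately have "?h \<in> carrier (tree_aut k)"
    using hp by (simp add: tree_aut_def)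
  moreover have "?h \<otimes>\<^bsub>tree_aut k\<^esub> g = \<one>\<^bsub>tree_aut k\<^esub>"
    using permutes_inv_o(2)[OF p] by (simp add: tree_aut_def)
  ultimately show "\<exists>h\<in>carrier (tree_aut k). h \<otimes>\<^bsub>tree_aut k\<^esub> g = \<one>\<^bsub>tree_aut k\<^esub>"
    by blast
next
  fix g h assume gh: "g \<in> carrier (tree_aut k)" "h \<in> carrier (tree_aut k)"
  then have hp: "h permutes words k"
    by (simp add: tree_aut_def)
  have mem: "h u \<in> words k" if "u \<in> words k" for u
    using that permutes_in_image[OF hp] by blast
  have "g permutes words k" "h permutes words k"
    using gh by (simp_all add: tree_aut_def)
  then have "(g \<circ> h) permutes words k"
    by (rule permutes_compose[rotated])
  with gh mem show "g \<otimes>\<^bsub>tree_aut k\<^esub> h \<in> carrier (tree_aut k)"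
    unfolding tree_aut_def by simp
qed (simp_all add: tree_aut_def permutes_id comp_assoc)

definition S1 :: "nat \<Rightarrow> (nat list \<Rightarrow> nat list) set"
  where "S1 k = {a \<in> carrier (tree_aut k).
    \<exists>j<k. sect a j = a \<and> root_perm a j = j \<and> (\<forall>i<k. i \<noteq> j \<longrightarrow> sect a i = id)}"

definition Hc :: "nat \<Rightarrow> (nat list \<Rightarrow> nat list) set"
  where "Hc k = generate (tree_aut k) (S1 k)"


section \<open>The limit space\<close>

definition quotient_topology :: "'a topology \<Rightarrow> ('a \<times> 'a) set \<Rightarrow> 'a set topology"
  where "quotient_topology X R =
    topology (\<lambda>U. U \<subseteq> topspace X // R \<and> openin X {x \<in> topspace X. R `` {x} \<in> U})"

lemma openin_quotient_topology:
  "openin (quotient_topology X R) U \<longleftrightarrow>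
     U \<subseteq> topspace X // R \<and> openin X {x \<in> topspace X. R `` {x} \<in> U}"
proof -
  have "istopology (\<lambda>U. U \<subseteq> topspace X // R \<and> openin X {x \<in> topspace X. R `` {x} \<in> U})"
    unfolding istopology_def
  proof (intro conjI allI impI)
    fix S T
    assume "S \<subseteq> topspace X // R \<and> openin X {x \<in> topspace X. R `` {x} \<in> S}"
      and "T \<subseteq> topspace X // R \<and> openin X {x \<in> topspace X. R `` {x} \<in> T}"
    moreover have "{x \<in> topspace X. R `` {x} \<in> S \<inter> T} =
        {x \<in> topspace X. R `` {x} \<in> S} \<inter> {x \<in> topspace X. R `` {x} \<in> T}"
      by auto
    ultimately show "S \<inter> T \<subseteq> topspace X // R" "openin X {x \<in> topspace X. R `` {x} \<in> S \<inter> T}"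
      by (auto simp: openin_Int)
  next
    fix \<U>
    assume *: "\<forall>S\<in>\<U>. S \<subseteq> topspace X // R \<and> openin X {x \<in> topspace X. R `` {x} \<in> S}"
    then show "\<Union>\<U> \<subseteq> topspace X // R"
      by blast
    have "{x \<in> topspace X. R `` {x} \<in> \<Union>\<U>} = (\<Union>S\<in>\<U>. {x \<in> topspace X. R `` {x} \<in> S})"
      by auto
    with * show "openin X {x \<in> topspace X. R `` {x} \<in> \<Union>\<U>}"
      by auto
  qed
  then show ?thesis
    unfolding quotient_topology_def by (simp add: topology_inverse')
qed

lemma topspace_quotient_topology: "topspace (quotient_topology X R) = topspace X // R"
proof -
  have "{x \<in> topspace X. R `` {x} \<in> topspace X // R} = topspace X"
    by (auto simp: quotient_def)
  then have "openin (quotient_topology X R) (topspace X // R)"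
    by (simp add: openin_quotient_topology)
  then have "topspace X // R \<subseteq> topspace (quotient_topology X R)"
    by (rule openin_subset)
  moreover have "topspace (quotient_topology X R) \<subseteq> topspace X // R"
    using openin_topspace[of "quotient_topology X R"]
    by (simp only: openin_quotient_topology)
  ultimately show ?thesis
    by (rule subset_antisym[rotated])
qed

lemma quotient_map_quotient_topology:
  "quotient_map X (quotient_topology X R) (\<lambda>x. R `` {x})"
  unfolding quotient_map_def topspace_quotient_topology openin_quotient_topology
proof (intro conjI allI impI)
  show "(\<lambda>x. R `` {x}) ` topspace X = topspace X // R"
    by (simp add: quotient_def UNION_singleton_eq_range)
qed simp

text \<open>A left-infinite sequence \<open>\<dots>x\<^sub>2x\<^sub>1\<close> is the function \<open>s\<close> with \<open>s n = x\<^sub>n\<^sub>+\<^sub>1\<close>,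
  and \<open>left_word s n\<close> is the word \<open>x\<^sub>n\<dots>x\<^sub>2x\<^sub>1\<close>.\<close>

definition left_seqs :: "nat \<Rightarrow> (nat \<Rightarrow> nat) topology"
  where "left_seqs k = product_topology (\<lambda>_. discrete_topology {..<k}) UNIV"

definition left_word :: "(nat \<Rightarrow> nat) \<Rightarrow> nat \<Rightarrow> nat list"
  where "left_word s n = rev (map s [0..<n])"

definition asymp_equiv_rel ::
    "nat \<Rightarrow> (nat list \<Rightarrow> nat list) set \<Rightarrow> ((nat \<Rightarrow> nat) \<times> (nat \<Rightarrow> nat)) set"
  where "asymp_equiv_rel k G = {(s, t).
    s \<in> topspace (left_seqs k) \<and> t \<in> topspace (left_seqs k) \<and>
    (\<exists>g :: nat \<Rightarrow> nat list \<Rightarrow> nat list. g ` {1..} \<subseteq> G \<and> finite (g ` {1..}) \<and>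
       (\<forall>n\<ge>1. g n (left_word s n) = left_word t n))}"

definition limit_space :: "nat \<Rightarrow> (nat list \<Rightarrow> nat list) set \<Rightarrow> (nat \<Rightarrow> nat) set topology"
  where "limit_space k G = quotient_topology (left_seqs k) (asymp_equiv_rel k G)"


section \<open>The self-similar set\<close>

definition regular_simplex_vertices :: "nat \<Rightarrow> (nat \<Rightarrow> 'a::euclidean_space) \<Rightarrow> bool"
  where "regular_simplex_vertices k p \<longleftrightarrow>
    inj_on p {..<k} \<and> \<not> affine_dependent (p ` {..<k}) \<and>
    (\<exists>s. \<forall>i<k. \<forall>j<k. i \<noteq> j \<longrightarrow> dist (p i) (p j) = s)"

definition facet_centre :: "nat \<Rightarrow> (nat \<Rightarrow> 'a::euclidean_space) \<Rightarrow> nat \<Rightarrow> 'a"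
  where "facet_centre k p i = (1 / (real k - 1)) *\<^sub>R (\<Sum>j \<in> {..<k} - {i}. p j)"

definition affine_map :: "('a::real_vector \<Rightarrow> 'b::real_vector) \<Rightarrow> bool"
  where "affine_map f \<longleftrightarrow> (\<exists>L c. linear L \<and> f = (\<lambda>x. L x + c))"

definition simplex_map :: "nat \<Rightarrow> (nat \<Rightarrow> 'a::euclidean_space) \<Rightarrow> nat \<Rightarrow> 'a \<Rightarrow> 'a"
  where "simplex_map k p i =
    (THE f. affine_map f \<and> f (p i) = p i \<and> (\<forall>j<k. j \<noteq> i \<longrightarrow> f (p j) = facet_centre k p j))"

definition self_similar_set :: "nat \<Rightarrow> (nat \<Rightarrow> 'a::euclidean_space) \<Rightarrow> 'a set"
  where "self_similar_set k p =
    (THE K. compact K \<and> K \<noteq> {} \<and> K = (\<Union>i<k. simplex_map k p i ` K))"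

end

theory Submission
  imports Defs
begin

text \<open>Write \<open>F i\<close> for the maps of the simplex. The contractions \<open>F i\<close> give a coding map that sends a
left-infinite sequence \<open>\<dots>x\<^sub>2x\<^sub>1\<close> to the single point in all the sets
\<open>F x\<^sub>1 (F x\<^sub>2 (\<dots> F x\<^sub>n \<Delta>))\<close>, where \<open>\<Delta>\<close> is the simplex. It is continuous on a compact
space and its image is the self-similar set, so the self-similar set is the quotient of the space
of sequences by the kernel of the coding map. The limit space is the quotient of the same space by
asymptotic equivalence, so the theorem says exactly that two sequences are asymptotically
equivalent iff they have the same code (\<open>asymp_equiv_iff_coding_eq\<close>).

Equivalent sequences have equal codes. A generator \<open>a\<close> with peg \<open>l\<close> turns the word
\<open>l\<dots>l i w\<close> into \<open>l\<dots>l j w\<close> with \<open>i, j \<noteq> l\<close>. The composites of the maps \<open>F\<close> along these two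
words agree at the vertex \<open>p l\<close>, because \<open>F l\<close> fixes \<open>p l\<close> and every other \<open>F i\<close> sends \<open>p l\<close> to
the centre of the facet opposite to it. So \<open>a\<close> moves a cell of level \<open>n\<close> to a cell that meets it,
and a fixed element of the group moves it by a distance of the order of the diameter of such cells
(\<open>Hc_moves_cylinders_little\<close>). Finitely many elements obey one common bound, which tends to \<open>0\<close>.

Sequences with equal codes are equivalent. In barycentric coordinates the maps are explicit, and two
points \<open>x, y\<close> of the simplex satisfy \<open>F i x = F j y\<close> for some \<open>i \<noteq> j\<close> only if \<open>x = y\<close> and the coordinates
\<open>i\<close> and \<open>j\<close> of \<open>x\<close> vanish (\<open>simplex_map_overlap\<close>). The only points of the self-similar set with two vanishing
coordinates are the vertices (\<open>coding_on_small_face\<close>), and \<open>p l\<close> has the single code \<open>\<dots>lll\<close>.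
Hence two different sequences with the same code are \<open>\<dots>lll i w\<close> and \<open>\<dots>lll j w\<close> with \<open>l \<noteq> i, j\<close>,
and the automorphism with peg \<open>l\<close> that swaps \<open>i\<close> and \<open>j\<close> relates them
(\<open>asymp_equiv_if_constant_tail\<close>).\<close>


section \<open>Quotient maps and left-infinite sequences\<close>

lemma homeomorphic_space_quotients_same_kernel:
  assumes f: "quotient_map X Y f" and h: "quotient_map X Z h"
    and kernel: "\<And>x y. x \<in> topspace X \<Longrightarrow> y \<in> topspace X \<Longrightarrow> f x = f y \<longleftrightarrow> h x = h y"
  shows "Y homeomorphic_space Z"
proof -
  obtain g where g: "continuous_map Y Z g" "\<And>x. x \<in> topspace X \<Longrightarrow> g (f x) = h x"
    using quotient_map_lift_exists[OF f quotient_imp_continuous_map[OF h]] kernel by metis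
  obtain g' where g': "continuous_map Z Y g'" "\<And>x. x \<in> topspace X \<Longrightarrow> g' (h x) = f x"
    using quotient_map_lift_exists[OF h quotient_imp_continuous_map[OF f]] kernel by metis
  have "homeomorphic_maps Y Z g g'"
    unfolding homeomorphic_maps_def
    using g g' quotient_imp_surjective_map[OF f] quotient_imp_surjective_map[OF h] by force
  then show ?thesis
    by (auto simp: homeomorphic_space_def)
qed

lemma topspace_left_seqs: "s \<in> topspace (left_seqs k) \<longleftrightarrow> (\<forall>n. s n < k)"
  by (auto simp: left_seqs_def PiE_iff)

lemma compact_space_left_seqs: "compact_space (left_seqs k)"
  by (simp add: left_seqs_def compact_space_product_topology compact_space_discrete_topology)

lemma openin_left_seqs_cylinder:
  assumes "s \<in> topspace (left_seqs k)"
  shows "openin (left_seqs k) {t \<in> topspace (left_seqs k). \<forall>m<n. t m = s m}"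
proof -
  let ?U = "\<lambda>m. if m < n then {s m} else {..<k}"
  have "{t \<in> topspace (left_seqs k). \<forall>m<n. t m = s m} = Pi\<^sub>E UNIV ?U"
    using assms by (auto simp: topspace_left_seqs PiE_iff split: if_splits)
  moreover have "openin (left_seqs k) (Pi\<^sub>E UNIV ?U)"
    unfolding left_seqs_def
  proof (rule product_topology_basis)
    show "openin (discrete_topology {..<k}) (?U m)" for m
      using assms by (auto simp: topspace_left_seqs)
    have "{m. ?U m \<noteq> topspace (discrete_topology {..<k})} \<subseteq> {..<n}"
      by auto
    then show "finite {m. ?U m \<noteq> topspace (discrete_topology {..<k})}"
      using finite_subset by blast
  qed
  ultimately show ?thesis
    by simp
qed

lemma left_word_Suc: "left_word s (Suc n) = s n # left_word s n"
  by (simp add: left_word_def)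

lemma left_word_Suc_shift: "left_word s (Suc n) = left_word (\<lambda>m. s (Suc m)) n @ [s 0]"
  by (simp add: left_word_def map_upt_Suc del: upt_Suc)

lemma length_left_word: "length (left_word s n) = n"
  by (simp add: left_word_def)

lemma left_word_in_words: "s \<in> topspace (left_seqs k) \<Longrightarrow> left_word s n \<in> words k"
  by (auto simp: left_word_def topspace_left_seqs)

lemma left_word_cong: "(\<And>m. m < n \<Longrightarrow> s m = t m) \<Longrightarrow> left_word s n = left_word t n"
  by (simp add: left_word_def)

lemma left_word_add: "left_word s (m + n) = left_word (\<lambda>i. s (i + n)) m @ left_word s n"
  by (induction m) (simp_all add: left_word_Suc, simp add: left_word_def)

lemma shift_in_left_seqs:
  "s \<in> topspace (left_seqs k) \<Longrightarrow> (\<lambda>m. s (m + n)) \<in> topspace (left_seqs k)"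
  "s \<in> topspace (left_seqs k) \<Longrightarrow> (\<lambda>m. s (Suc m)) \<in> topspace (left_seqs k)"
  by (auto simp: topspace_left_seqs)


section \<open>The coding map of a contractive iterated function system\<close>

text \<open>The contraction \<open>f i\<close> corresponds to writing the letter \<open>i\<close> at the right end of a left-infinite sequence. Since
\<open>left_word s n\<close> lists the letters from the oldest to the most recent one, \<open>fold f (left_word s n)\<close> is
\<open>f (s 0) \<circ> \<dots> \<circ> f (s (n - 1))\<close>: the map of the last letter of a word is applied last.\<close>
locale contracting_ifs =
  fixes k :: nat and f :: "nat \<Rightarrow> 'a::complete_space \<Rightarrow> 'a" and r :: real
  assumes k_pos: "0 < k" and r_nonneg: "0 \<le> r" and r_less_1: "r < 1"
    and contraction: "\<And>i x y. i < k \<Longrightarrow> dist (f i x) (f i y) \<le> r * dist x y"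
begin

lemma dist_fold_le:
  "u \<in> words k \<Longrightarrow> dist (fold f u x) (fold f u y) \<le> r ^ length u * dist x y"
proof (induction u arbitrary: x y)
  case (Cons i u)
  then have "dist (fold f (i # u) x) (fold f (i # u) y) \<le> r ^ length u * dist (f i x) (f i y)"
    by auto
  also have "\<dots> \<le> r ^ length u * (r * dist x y)"
    using Cons.prems by (intro mult_left_mono contraction) (auto simp: r_nonneg)
  finally show ?case
    by (simp add: mult_ac)
qed simp

text \<open>The bound \<open>C / (1 - r)\<close> is the solution of \<open>R = C + r * R\<close>, so that the ball of that radius is mapped
into itself as soon as \<open>C\<close> bounds the displacements of its centre.\<close>
lemma fold_orbit_bounded: "\<exists>R. \<forall>u \<in> words k. dist x (fold f u x) \<le> R"
proof -
  define C where "C = Max ((\<lambda>i. dist x (f i x)) ` {..<k})"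
  have C: "dist x (f i x) \<le> C" if "i < k" for i
    unfolding C_def using that by (intro Max_ge) auto
  have "0 \<le> C"
    using C[OF k_pos] zero_le_dist order_trans by blast
  have "dist x (fold f u x) \<le> C / (1 - r)" if "u \<in> words k" for u
    using that
  proof (induction u rule: rev_induct)
    case Nil
    then show ?case
      using \<open>0 \<le> C\<close> r_less_1 by simp
  next
    case (snoc i u)
    then have i: "i < k" and IH: "dist x (fold f u x) \<le> C / (1 - r)"
      by auto
    have "dist x (fold f (u @ [i]) x) \<le> dist x (f i x) + dist (f i x) (f i (fold f u x))"
      by (simp add: dist_triangle)
    also have "\<dots> \<le> C + r * dist x (fold f u x)"
      using C[OF i] contraction[OF i] by (rule add_mono)
    also have "\<dots> \<le> C + r * (C / (1 - r))"
      using mult_left_mono[OF IH r_nonneg] by simp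
    also have "\<dots> = C / (1 - r)"
      using r_less_1 by (simp add: field_simps)
    finally show ?case .
  qed
  then show ?thesis
    by blast
qed

lemma power_mult_tendsto_0: "(\<lambda>n. r ^ n * C) \<longlonglongrightarrow> 0"
  using LIMSEQ_realpow_zero[OF r_nonneg r_less_1] by (rule tendsto_mult_left_zero)

lemma power_mult_less:
  assumes "0 < e"
  obtains n where "\<bar>r ^ n * C\<bar> < e"
  using LIMSEQ_D[OF power_mult_tendsto_0[of C] assms] by auto

text \<open>Quantifying over the starting point \<open>x\<close> makes the coding map independent of a base point.\<close>
definition coding :: "(nat \<Rightarrow> nat) \<Rightarrow> 'a"
  where "coding s = (THE z. \<forall>x. (\<lambda>n. fold f (left_word s n) x) \<longlonglongrightarrow> z)"

lemma coding_tendsto: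
  assumes s: "s \<in> topspace (left_seqs k)"
  shows "(\<lambda>n. fold f (left_word s n) x) \<longlonglongrightarrow> coding s"
proof -
  fix b :: 'a
  obtain R where R: "\<And>u. u \<in> words k \<Longrightarrow> dist b (fold f u b) \<le> R"
    using fold_orbit_bounded by blast
  let ?a = "\<lambda>x n. fold f (left_word s n) x"
  have step: "dist (?a b n) (?a b (m + n)) \<le> r ^ n * R" for m n
  proof -
    have "?a b (m + n) = fold f (left_word s n) (fold f (left_word (\<lambda>i. s (i + n)) m) b)"
      by (simp add: left_word_add)
    then have "dist (?a b n) (?a b (m + n))
        \<le> r ^ n * dist b (fold f (left_word (\<lambda>i. s (i + n)) m) b)"
      using dist_fold_le[OF left_word_in_words[OF s]] by (simp add: length_left_word)
    also have "\<dots> \<le> r ^ n * R"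
      using s by (intro mult_left_mono R left_word_in_words shift_in_left_seqs) (simp_all add: r_nonneg)
    finally show ?thesis .
  qed
  have "Cauchy (?a b)"
  proof (rule metric_CauchyI)
    fix e :: real assume "0 < e"
    obtain N where N: "\<bar>r ^ N * R\<bar> < e / 2"
      using power_mult_less[of "e / 2"] \<open>0 < e\<close> by auto
    have near: "dist (?a b N) (?a b n) < e / 2" if "N \<le> n" for n
      using step[of N "n - N"] N that by simp
    have "dist (?a b m) (?a b n) < e" if "N \<le> m" "N \<le> n" for m n
      using near[OF that(1)] near[OF that(2)] dist_triangle_half_r by blast
    then show "\<exists>M. \<forall>m\<ge>M. \<forall>n\<ge>M. dist (?a b m) (?a b n) < e"
      by blast
  qed
  then obtain z where z: "?a b \<longlonglongrightarrow> z"
    using Cauchy_convergent convergent_def by blast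
  have lim: "?a x \<longlonglongrightarrow> z" for x
  proof -
    have bound: "dist (?a x n) z \<le> r ^ n * dist x b + dist (?a b n) z" for n
      using dist_fold_le[OF left_word_in_words[OF s], of n x b]
        dist_triangle[of "?a x n" z "?a b n"] by (simp add: length_left_word)
    have "(\<lambda>n. r ^ n * dist x b + dist (?a b n) z) \<longlonglongrightarrow> 0 + 0"
      using z by (intro tendsto_add power_mult_tendsto_0) (rule iffD1[OF tendsto_dist_iff])
    then have "(\<lambda>n. r ^ n * dist x b + dist (?a b n) z) \<longlonglongrightarrow> 0"
      by simp
    then have "(\<lambda>n. dist (?a x n) z) \<longlonglongrightarrow> 0"
      by (rule tendsto_sandwich[OF _ _ tendsto_const, rotated 2]) (simp_all add: bound)
    then show ?thesis
      by (rule iffD2[OF tendsto_dist_iff])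
  qed
  have "coding s = z"
    unfolding coding_def by (rule the_equality) (use lim LIMSEQ_unique in blast)+
  then show ?thesis
    using lim by simp
qed

lemma coding_unfold:
  assumes s: "s \<in> topspace (left_seqs k)"
  shows "coding s = f (s 0) (coding (\<lambda>m. s (Suc m)))"
proof -
  let ?t = "\<lambda>m. s (Suc m)"
  fix b :: 'a
  have s0: "s 0 < k"
    using s by (simp add: topspace_left_seqs)
  have lim: "(\<lambda>n. fold f (left_word ?t n) b) \<longlonglongrightarrow> coding ?t"
    using s by (intro coding_tendsto shift_in_left_seqs)
  have "(\<lambda>n. f (s 0) (fold f (left_word ?t n) b)) \<longlonglongrightarrow> f (s 0) (coding ?t)"
  proof (rule iffD2[OF tendsto_dist_iff], rule tendsto_sandwich[OF _ _ tendsto_const])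
    show "\<forall>\<^sub>F n in sequentially. dist (f (s 0) (fold f (left_word ?t n) b)) (f (s 0) (coding ?t))
        \<le> r * dist (fold f (left_word ?t n) b) (coding ?t)"
      by (simp add: contraction[OF s0])
    show "(\<lambda>n. r * dist (fold f (left_word ?t n) b) (coding ?t)) \<longlonglongrightarrow> 0"
      using lim by (intro tendsto_mult_right_zero) (rule iffD1[OF tendsto_dist_iff])
  qed simp
  moreover have "(\<lambda>n. f (s 0) (fold f (left_word ?t n) b)) = (\<lambda>n. fold f (left_word s (Suc n)) b)"
    by (simp add: left_word_Suc_shift)
  moreover have "(\<lambda>n. fold f (left_word s (Suc n)) b) \<longlonglongrightarrow> coding s"
    using coding_tendsto[OF s] by (rule LIMSEQ_Suc)
  ultimately show ?thesis
    using LIMSEQ_unique by metis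
qed

text \<open>Two sequences that agree in their last \<open>n\<close> letters therefore have codes in the image of one \<open>n\<close>-fold
composite; continuity of the coding map is a consequence.\<close>
lemma coding_eq_fold:
  "s \<in> topspace (left_seqs k) \<Longrightarrow> coding s = fold f (left_word s n) (coding (\<lambda>m. s (m + n)))"
proof (induction n)
  case 0
  then show ?case
    by (simp add: left_word_def)
next
  case (Suc n)
  have "coding (\<lambda>m. s (m + n)) = f (s n) (coding (\<lambda>m. s (m + Suc n)))"
    using coding_unfold[of "\<lambda>m. s (m + n)"] Suc.prems by (simp add: shift_in_left_seqs)
  then show ?case
    using Suc by (simp add: left_word_Suc)
qed

lemma coding_in_closed:
  assumes s: "s \<in> topspace (left_seqs k)" and T: "closed T" "T \<noteq> {}"
    and inv: "\<And>i x. i < k \<Longrightarrow> x \<in> T \<Longrightarrow> f i x \<in> T"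
  shows "coding s \<in> T"
proof -
  obtain b where "b \<in> T"
    using T by blast
  have "fold f u x \<in> T" if "u \<in> words k" "x \<in> T" for u x
    using that by (induction u arbitrary: x) (auto intro: inv)
  then have "fold f (left_word s n) b \<in> T" for n
    using left_word_in_words[OF s] \<open>b \<in> T\<close> by blast
  then show ?thesis
    using closed_sequentially[OF T(1) _ coding_tendsto[OF s, of b]] by blast
qed

lemma coding_bounded:
  "\<exists>D. \<forall>s \<in> topspace (left_seqs k). \<forall>t \<in> topspace (left_seqs k). dist (coding s) (coding t) \<le> D"
proof -
  fix b :: 'a
  obtain R where R: "\<And>u. u \<in> words k \<Longrightarrow> dist b (fold f u b) \<le> R"
    using fold_orbit_bounded by blast
  have "dist b (coding s) \<le> R" if s: "s \<in> topspace (left_seqs k)" for s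
    using R[OF left_word_in_words[OF s]]
    by (intro LIMSEQ_le_const2[OF tendsto_dist[OF tendsto_const coding_tendsto[OF s]]]) auto
  then have "dist (coding s) (coding t) \<le> R + R"
    if "s \<in> topspace (left_seqs k)" "t \<in> topspace (left_seqs k)" for s t
    using that by (metis add_mono dist_commute dist_triangle order_trans)
  then show ?thesis
    by blast
qed

lemma continuous_map_coding: "continuous_map (left_seqs k) euclidean coding"
  unfolding continuous_map_eq_topcontinuous_at topcontinuous_at_def
proof (intro ballI conjI allI impI; (elim conjE)?)
  fix s U
  assume s: "s \<in> topspace (left_seqs k)" and U: "openin euclidean U" "coding s \<in> U"
  obtain D where D: "\<And>s t. s \<in> topspace (left_seqs k) \<Longrightarrow> t \<in> topspace (left_seqs k) \<Longrightarrow>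
      dist (coding s) (coding t) \<le> D"
    using coding_bounded by blast
  obtain e where e: "0 < e" "ball (coding s) e \<subseteq> U"
    using U open_contains_ball by (metis open_openin)
  obtain n where n: "\<bar>r ^ n * D\<bar> < e"
    using power_mult_less[OF e(1)] .
  let ?V = "{t \<in> topspace (left_seqs k). \<forall>m<n. t m = s m}"
  have "coding t \<in> U" if t: "t \<in> ?V" for t
  proof -
    have "left_word t n = left_word s n"
      using t by (intro left_word_cong) auto
    then have "dist (coding s) (coding t) \<le> r ^ n * dist (coding (\<lambda>m. s (m + n))) (coding (\<lambda>m. t (m + n)))"
      using coding_eq_fold[of s n] coding_eq_fold[of t n] s t
        dist_fold_le[OF left_word_in_words[OF s, of n]]
      by (simp add: length_left_word)
    also have "\<dots> \<le> r ^ n * D"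
      using s t by (intro mult_left_mono D shift_in_left_seqs) (simp_all add: r_nonneg)
    finally have "dist (coding s) (coding t) < e"
      using n by linarith
    then show ?thesis
      using e(2) by auto
  qed
  then show "\<exists>V. openin (left_seqs k) V \<and> s \<in> V \<and> (\<forall>t\<in>V. coding t \<in> U)"
    using openin_left_seqs_cylinder[OF s, of n] s by (intro exI[of _ ?V]) auto
qed auto

lemma coding_image_self_similar:
  "coding ` topspace (left_seqs k) = (\<Union>i<k. f i ` coding ` topspace (left_seqs k))"
proof (intro equalityI subsetI)
  fix x assume "x \<in> coding ` topspace (left_seqs k)"
  then obtain s where s: "s \<in> topspace (left_seqs k)" "x = coding s"
    by blast
  then show "x \<in> (\<Union>i<k. f i ` coding ` topspace (left_seqs k))"
    using coding_unfold[OF s(1)] shift_in_left_seqs(2)[OF s(1)] topspace_left_seqs[of s k] by blast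
next
  fix x assume "x \<in> (\<Union>i<k. f i ` coding ` topspace (left_seqs k))"
  then obtain i s where s: "i < k" "s \<in> topspace (left_seqs k)" "x = f i (coding s)"
    by blast
  let ?t = "case_nat i s"
  have t: "?t \<in> topspace (left_seqs k)"
    using s by (auto simp: topspace_left_seqs split: nat.split)
  then have "x = coding ?t"
    using coding_unfold[OF t] s by simp
  then show "x \<in> coding ` topspace (left_seqs k)"
    using t by blast
qed

lemma compact_coding_image: "compact (coding ` topspace (left_seqs k))"
  using image_compactin[OF _ continuous_map_coding] compact_space_left_seqs
  by (simp add: compact_space_def)

lemma coding_image_nonempty: "coding ` topspace (left_seqs k) \<noteq> {}"
  using k_pos topspace_left_seqs[of "\<lambda>_. 0" k] by auto

text \<open>A point of \<open>K\<close> can be pulled back through the maps \<open>f i\<close> without leaving \<open>K\<close>. The indices of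
the maps used form a sequence, and the point is its code because \<open>K\<close> is bounded.\<close>
lemma self_similar_eq_coding_image:
  assumes K: "compact K" "K \<noteq> {}" and self: "K = (\<Union>i<k. f i ` K)"
  shows "K = coding ` topspace (left_seqs k)"
proof (intro equalityI subsetI)
  fix x assume "x \<in> coding ` topspace (left_seqs k)"
  moreover have "f i y \<in> K" if "i < k" "y \<in> K" for i y
    using self that by blast
  ultimately show "x \<in> K"
    using coding_in_closed[of _ K] K compact_imp_closed by blast
next
  fix x assume x: "x \<in> K"
  have "\<forall>y\<in>K. \<exists>i z. i < k \<and> z \<in> K \<and> y = f i z"
    using self by blast
  then obtain letter preimage where branch:
      "\<And>y. y \<in> K \<Longrightarrow> letter y < k \<and> preimage y \<in> K \<and> y = f (letter y) (preimage y)"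
    by metis
  define orbit where "orbit = (\<lambda>n. (preimage ^^ n) x)"
  define s where "s = (\<lambda>n. letter (orbit n))"
  have orbit: "orbit n \<in> K" for n
    unfolding orbit_def using x branch by (induction n) auto
  have s: "s \<in> topspace (left_seqs k)"
    using branch orbit by (auto simp: topspace_left_seqs s_def)
  have x_eq: "x = fold f (left_word s n) (orbit n)" for n
  proof (induction n)
    case 0
    then show ?case
      by (simp add: orbit_def left_word_def)
  next
    case (Suc n)
    have "orbit n = f (s n) (orbit (Suc n))"
      using branch[OF orbit[of n]] by (simp add: s_def orbit_def)
    then show ?case
      using Suc by (simp add: left_word_Suc)
  qed
  obtain D where D: "\<And>y. y \<in> K \<Longrightarrow> dist x y \<le> D"
    using compact_imp_bounded[OF K(1)] bounded_any_center by metis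
  have "(\<lambda>n. fold f (left_word s n) x) \<longlonglongrightarrow> x"
  proof (rule iffD2[OF tendsto_dist_iff], rule tendsto_sandwich[OF _ _ tendsto_const power_mult_tendsto_0])
    have "dist (fold f (left_word s n) x) x \<le> r ^ n * D" for n
    proof -
      have "dist (fold f (left_word s n) x) x \<le> r ^ n * dist x (orbit n)"
        using dist_fold_le[OF left_word_in_words[OF s, of n], of x "orbit n"] x_eq[of n]
        by (simp add: length_left_word)
      also have "\<dots> \<le> r ^ n * D"
        using D[OF orbit] by (intro mult_left_mono) (simp_all add: r_nonneg)
      finally show ?thesis .
    qed
    then show "\<forall>\<^sub>F n in sequentially. dist (fold f (left_word s n) x) x \<le> r ^ n * D"
      by simp
  qed simp
  then have "x = coding s"
    using coding_tendsto[OF s] LIMSEQ_unique by blast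
  then show "x \<in> coding ` topspace (left_seqs k)"
    using s by blast
qed

lemma the_self_similar_set:
  "(THE K. compact K \<and> K \<noteq> {} \<and> K = (\<Union>i<k. f i ` K)) = coding ` topspace (left_seqs k)"
proof (rule the_equality)
  show "compact (coding ` topspace (left_seqs k)) \<and> coding ` topspace (left_seqs k) \<noteq> {} \<and>
      coding ` topspace (left_seqs k) = (\<Union>i<k. f i ` coding ` topspace (left_seqs k))"
    using compact_coding_image coding_image_nonempty coding_image_self_similar by blast
qed (use self_similar_eq_coding_image in blast)

lemma quotient_map_coding:
  "quotient_map (left_seqs k) (top_of_set (coding ` topspace (left_seqs k))) coding"
proof (rule T1_Spaces.continuous_imp_quotient_map[OF _ compact_space_left_seqs])
  show "continuous_map (left_seqs k) (top_of_set (coding ` topspace (left_seqs k))) coding"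
    using continuous_map_coding by (auto simp: continuous_map_in_subtopology)
qed (auto intro: Hausdorff_space_subtopology)

end


section \<open>Group elements move cells of high level little\<close>

lemma tree_aut_words:
  assumes "g \<in> carrier (tree_aut k)" "u \<in> words k"
  shows "g u \<in> words k" and "length (g u) = length u"
  using assms permutes_in_image[of g "words k" u] by (auto simp: tree_aut_def)

lemma root_perm_less:
  assumes "g \<in> carrier (tree_aut k)" "x < k"
  shows "root_perm g x < k"
proof -
  have "[x] \<in> words k"
    using assms(2) by simp
  from tree_aut_words[OF assms(1) this] show ?thesis
    by (cases "g [x]") (auto simp: root_perm_def)
qed

lemma root_perm_inject:
  assumes g: "g \<in> carrier (tree_aut k)" and xy: "x < k" "y < k" and eq: "root_perm g x = root_perm g y"
  shows "x = y"
proof -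
  have "[x] \<in> words k" "[y] \<in> words k"
    using xy by simp_all
  from tree_aut_words(2)[OF g this(1)] tree_aut_words(2)[OF g this(2)]
  have "g [x] = g [y]"
    using eq by (auto simp: root_perm_def length_Suc_conv)
  then show ?thesis
    using g permutes_inj[of g "words k"] by (auto simp: tree_aut_def dest: injD)
qed

text \<open>Up to the first letter different from the peg \<open>l\<close> the generator changes nothing and the maps \<open>f l\<close> fix
\<open>p l\<close>. At that letter the hypothesis \<open>opposite\<close> makes the change invisible at \<open>p l\<close>, and
afterwards the section is trivial.\<close>
lemma peg_generator_fold:
  assumes a: "a \<in> S1 k"
    and fixed: "\<And>l. l < k \<Longrightarrow> f l (p l) = p l"
    and opposite: "\<And>l i j. \<lbrakk>l < k; i < k; j < k; i \<noteq> l; j \<noteq> l\<rbrakk> \<Longrightarrow> f i (p l) = f j (p l)"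
  shows "\<exists>l<k. \<forall>u \<in> words k. fold f (a u) (p l) = fold f u (p l)"
proof -
  obtain l where l: "l < k" "sect a l = a" "root_perm a l = l"
      and sect_id: "\<And>i. i < k \<Longrightarrow> i \<noteq> l \<Longrightarrow> sect a i = id"
      and aut: "a \<in> carrier (tree_aut k)"
    using a by (auto simp: S1_def)
  have "fold f (a u) (p l) = fold f u (p l)" if "u \<in> words k" for u
    using that
  proof (induction u)
    case Nil
    then show ?case
      using tree_aut_words(2)[OF aut, of "[]"] by simp
  next
    case (Cons x u)
    then have x: "x < k" and u: "u \<in> words k"
      by auto
    show ?case
    proof (cases "x = l")
      case True
      then show ?thesis
        using sect_eq[OF aut x u] Cons.IH l fixed by simp
    next
      case False
      then have "root_perm a x \<noteq> l"
        using root_perm_inject[OF aut x l(1)] l(3) by auto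
      then have "f (root_perm a x) (p l) = f x (p l)"
        using False root_perm_less[OF aut x] x l(1) by (intro opposite)
      then show ?thesis
        using sect_eq[OF aut x u] sect_id[OF x False] by simp
    qed
  qed
  then show ?thesis
    using l(1) by blast
qed

context contracting_ifs
begin

text \<open>For a generator, compare both points with the point \<open>fold f u (p l)\<close> that the two cells have in common.
Inverses and products preserve such a bound because automorphisms preserve the length of words.\<close>
lemma Hc_moves_cylinders_little:
  assumes g: "g \<in> Hc k"
    and fixed: "\<And>l. l < k \<Longrightarrow> f l (p l) = p l"
    and opposite: "\<And>l i j. \<lbrakk>l < k; i < k; j < k; i \<noteq> l; j \<noteq> l\<rbrakk> \<Longrightarrow> f i (p l) = f j (p l)"
  shows "\<exists>C. \<forall>u \<in> words k. dist (fold f u b) (fold f (g u) b) \<le> r ^ length u * C"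
proof -
  interpret aut: group "tree_aut k"
    by (rule group_tree_aut)
  have S1_sub: "S1 k \<subseteq> carrier (tree_aut k)"
    by (auto simp: S1_def)
  have generator: "\<exists>C. \<forall>u \<in> words k. dist (fold f u b) (fold f (a u) b) \<le> r ^ length u * C"
    if a: "a \<in> S1 k" for a
  proof -
    have aut: "a \<in> carrier (tree_aut k)"
      using a S1_sub by blast
    obtain l where "l < k" and l: "\<And>u. u \<in> words k \<Longrightarrow> fold f (a u) (p l) = fold f u (p l)"
      using peg_generator_fold[OF a, of f p] fixed opposite by blast
    have "dist (fold f u b) (fold f (a u) b) \<le> r ^ length u * (2 * dist b (p l))" if u: "u \<in> words k" for u
      using dist_triangle2[of "fold f u b" "fold f (a u) b" "fold f u (p l)"] l[OF u]
        dist_fold_le[OF u, of b "p l"] dist_fold_le[OF tree_aut_words(1)[OF aut u], of b "p l"]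
        tree_aut_words(2)[OF aut u]
      by (simp add: algebra_simps)
    then show ?thesis
      by blast
  qed
  show ?thesis
    using g unfolding Hc_def
  proof (induction rule: generate.induct)
    case one
    have "\<forall>u \<in> words k. dist (fold f u b) (fold f (\<one>\<^bsub>tree_aut k\<^esub> u) b) \<le> r ^ length u * 0"
      by (simp add: tree_aut_def)
    then show ?case
      by blast
  next
    case (incl a)
    then show ?case
      by (rule generator)
  next
    case (inv a)
    let ?b = "inv\<^bsub>tree_aut k\<^esub> a"
    have a: "a \<in> carrier (tree_aut k)"
      using inv S1_sub by blast
    then have "a \<circ> ?b = id"
      using aut.r_inv[OF a] by (simp add: tree_aut_def)
    then have ab: "a (?b u) = u" for u
      by (metis comp_apply id_apply)
    obtain C where C: "\<And>u. u \<in> words k \<Longrightarrow> dist (fold f u b) (fold f (a u) b) \<le> r ^ length u * C"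
      using generator[OF inv] by blast
    have "dist (fold f u b) (fold f (?b u) b) \<le> r ^ length u * C" if u: "u \<in> words k" for u
      using C[OF tree_aut_words(1)[OF aut.inv_closed[OF a] u]] tree_aut_words(2)[OF aut.inv_closed[OF a] u]
      by (simp add: ab dist_commute)
    then show ?case
      by blast
  next
    case (eng g h)
    obtain C D where C: "\<And>u. u \<in> words k \<Longrightarrow> dist (fold f u b) (fold f (g u) b) \<le> r ^ length u * C"
      and D: "\<And>u. u \<in> words k \<Longrightarrow> dist (fold f u b) (fold f (h u) b) \<le> r ^ length u * D"
      using eng.IH by blast
    have h: "h \<in> carrier (tree_aut k)"
      using aut.generate_in_carrier[OF S1_sub eng.hyps(2)] .
    have mult: "(g \<otimes>\<^bsub>tree_aut k\<^esub> h) u = g (h u)" for u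
      by (simp add: tree_aut_def)
    have "dist (fold f u b) (fold f ((g \<otimes>\<^bsub>tree_aut k\<^esub> h) u) b) \<le> r ^ length u * (D + C)"
      if u: "u \<in> words k" for u
      using dist_triangle[of "fold f u b" "fold f (g (h u)) b" "fold f (h u) b"]
        D[OF u] C[OF tree_aut_words(1)[OF h u]] tree_aut_words(2)[OF h u]
      by (simp add: mult algebra_simps)
    then show ?case
      by blast
  qed
qed

text \<open>The sequence \<open>g\<close> takes finitely many values, so the constants of the previous lemma have a common
bound.\<close>
lemma asymp_equiv_imp_coding_eq:
  assumes st: "(s, t) \<in> asymp_equiv_rel k (Hc k)"
    and fixed: "\<And>l. l < k \<Longrightarrow> f l (p l) = p l"
    and opposite: "\<And>l i j. \<lbrakk>l < k; i < k; j < k; i \<noteq> l; j \<noteq> l\<rbrakk> \<Longrightarrow> f i (p l) = f j (p l)"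
  shows "coding s = coding t"
proof -
  fix b :: 'a
  obtain g where s: "s \<in> topspace (left_seqs k)" and t: "t \<in> topspace (left_seqs k)"
    and g: "g ` {1..} \<subseteq> Hc k" "finite (g ` {1..})" "\<And>n. 1 \<le> n \<Longrightarrow> g n (left_word s n) = left_word t n"
    using st by (auto simp: asymp_equiv_rel_def)
  have "\<exists>C. \<forall>u \<in> words k. dist (fold f u b) (fold f (h u) b) \<le> r ^ length u * C"
    if "h \<in> g ` {1..}" for h
    using that g(1) Hc_moves_cylinders_little[of h p b] fixed opposite by blast
  then obtain C where C: "\<And>h u. h \<in> g ` {1..} \<Longrightarrow> u \<in> words k \<Longrightarrow>
      dist (fold f u b) (fold f (h u) b) \<le> r ^ length u * C h"
    by metis
  define M where "M = Max (C ` g ` {1..})"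
  have bound: "dist (fold f (left_word s n) b) (fold f (left_word t n) b) \<le> r ^ n * M" if n: "1 \<le> n" for n
  proof -
    have "dist (fold f (left_word s n) b) (fold f (left_word t n) b) \<le> r ^ n * C (g n)"
      using C[of "g n" "left_word s n"] n g(3)[OF n] left_word_in_words[OF s]
      by (simp add: length_left_word)
    also have "\<dots> \<le> r ^ n * M"
      unfolding M_def using n g(2) by (intro mult_left_mono Max_ge) (auto simp: r_nonneg)
    finally show ?thesis .
  qed
  have "(\<lambda>n. dist (fold f (left_word s n) b) (fold f (left_word t n) b)) \<longlonglongrightarrow> 0"
  proof (rule tendsto_sandwich[OF _ _ tendsto_const power_mult_tendsto_0])
    show "\<forall>\<^sub>F n in sequentially. dist (fold f (left_word s n) b) (fold f (left_word t n) b) \<le> r ^ n * M"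
      using bound by (rule eventually_sequentiallyI)
  qed simp
  moreover have "(\<lambda>n. dist (fold f (left_word s n) b) (fold f (left_word t n) b))
      \<longlonglongrightarrow> dist (coding s) (coding t)"
    using s t by (intro tendsto_dist coding_tendsto)
  ultimately have "dist (coding s) (coding t) = 0"
    using LIMSEQ_unique by blast
  then show ?thesis
    by simp
qed

end


section \<open>Automorphisms that swap two letters\<close>

fun peg_swap_word :: "nat \<Rightarrow> (nat \<Rightarrow> nat) \<Rightarrow> nat list \<Rightarrow> nat list"
  where
    "peg_swap_word l \<sigma> [] = []"
  | "peg_swap_word l \<sigma> (x # u) = (if x = l then l # peg_swap_word l \<sigma> u else \<sigma> x # u)"

text \<open>The identity outside the words over the alphabet is forced by the convention on automorphisms.\<close>
definition peg_swap :: "nat \<Rightarrow> nat \<Rightarrow> nat \<Rightarrow> nat \<Rightarrow> nat list \<Rightarrow> nat list"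
  where "peg_swap k l i j u = (if u \<in> words k then peg_swap_word l (Transposition.transpose i j) u else u)"

text \<open>The map is an involution that commutes with taking prefixes, which gives bijectivity and both
directions of the condition on common prefixes.\<close>
lemma peg_swap_in_S1:
  assumes "l < k" "i < k" "j < k" "l \<noteq> i" "l \<noteq> j"
  shows "peg_swap k l i j \<in> S1 k"
proof -
  let ?w = "peg_swap_word l (Transposition.transpose i j)"
  have tl: "Transposition.transpose i j x = l \<longleftrightarrow> x = l" for x
    using assms by (auto simp: Transposition.transpose_def)
  have words: "?w u \<in> words k" if "u \<in> words k" for u
    using that assms by (induction u) (auto simp: Transposition.transpose_def)
  have invol: "?w (?w u) = u" for u
    by (induction u) (auto simp: tl)
  have length: "length (?w u) = length u" for u
    by (induction u) auto
  have take: "?w (take n u) = take n (?w u)" for n u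
    by (induction u arbitrary: n) (auto simp: take_Cons split: nat.split)
  have "peg_swap k l i j (peg_swap k l i j u) = u" for u
    by (simp add: peg_swap_def words invol)
  then have "bij (peg_swap k l i j)"
    by (rule involuntory_imp_bij)
  then have "peg_swap k l i j permutes words k"
    by (simp add: permutes_def bij_iff peg_swap_def)
  moreover have "take n (?w u) = take n (?w v) \<longleftrightarrow> take n u = take n v" for n u v
    using invol by (metis take)
  ultimately have "peg_swap k l i j \<in> carrier (tree_aut k)"
    by (auto simp: tree_aut_def peg_swap_def length)
  moreover have "sect (peg_swap k l i j) l = peg_swap k l i j" "root_perm (peg_swap k l i j) l = l"
    using assms by (auto simp: sect_def root_perm_def peg_swap_def)
  moreover have "sect (peg_swap k l i j) x = id" if "x \<noteq> l" for x
    using that by (auto simp: sect_def peg_swap_def)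
  ultimately show ?thesis
    using assms(1) by (auto simp: S1_def)
qed

lemma peg_swap_replicate:
  assumes "l < k" "i < k" "i \<noteq> l" "w \<in> words k"
  shows "peg_swap k l i j (replicate n l @ i # w) = replicate n l @ j # w"
proof -
  have "peg_swap_word l (Transposition.transpose i j) (replicate n l @ i # w) = replicate n l @ j # w"
    using assms(3) by (induction n) auto
  then show ?thesis
    using assms by (auto simp: peg_swap_def)
qed

lemma id_in_Hc: "id \<in> Hc k"
  using generate.one[of "tree_aut k" "S1 k"] by (simp add: Hc_def tree_aut_def)

lemma S1_subset_Hc: "S1 k \<subseteq> Hc k"
  by (auto simp: Hc_def intro: generate.incl)

lemma left_word_constant_tail:
  assumes "\<And>n. m < n \<Longrightarrow> s n = l"
  shows "left_word s (d + Suc m) = replicate d l @ s m # left_word s m"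
  by (induction d) (simp_all add: left_word_Suc assms)

text \<open>The sequences are \<open>\<dots>lll i w\<close> and \<open>\<dots>lll j w\<close> with \<open>|w| = m\<close>. Words that lie inside \<open>w\<close> are related by the
identity and longer ones by a single swap, so two group elements suffice.\<close>
lemma asymp_equiv_if_constant_tail:
  assumes s: "s \<in> topspace (left_seqs k)" and t: "t \<in> topspace (left_seqs k)"
    and common: "\<And>n. n < m \<Longrightarrow> s n = t n"
    and tails: "\<And>n. m < n \<Longrightarrow> s n = l" "\<And>n. m < n \<Longrightarrow> t n = l"
    and ne: "l < k" "l \<noteq> s m" "l \<noteq> t m"
  shows "(s, t) \<in> asymp_equiv_rel k (Hc k)"
proof -
  let ?a = "peg_swap k l (s m) (t m)"
  define g where "g = (\<lambda>n. if n \<le> m then id else ?a)"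
  have "?a \<in> Hc k"
    using peg_swap_in_S1[of l k "s m" "t m"] S1_subset_Hc ne s t by (auto simp: topspace_left_seqs)
  then have "g ` {1..} \<subseteq> Hc k"
    by (auto simp: g_def id_in_Hc)
  moreover have "finite (g ` {1..})"
    by (rule finite_subset[of _ "{id, ?a}"]) (auto simp: g_def)
  moreover have "g n (left_word s n) = left_word t n" for n
  proof (cases "n \<le> m")
    case True
    then show ?thesis
      using left_word_cong[of n s t] common by (simp add: g_def)
  next
    case False
    then obtain d where d: "n = d + Suc m"
      by (metis add.commute le_add_diff_inverse not_less_eq_eq)
    have "left_word s m = left_word t m"
      using common by (rule left_word_cong)
    moreover have "left_word s n = replicate d l @ s m # left_word s m"
      unfolding d using tails(1) by (rule left_word_constant_tail)
    moreover have "left_word t n = replicate d l @ t m # left_word t m"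
      unfolding d using tails(2) by (rule left_word_constant_tail)
    moreover have "s m < k"
      using s by (simp add: topspace_left_seqs)
    ultimately have "?a (left_word s n) = left_word t n"
      using peg_swap_replicate[of l k "s m" "left_word s m" "t m" d] ne left_word_in_words[OF s, of m]
      by simp
    then show ?thesis
      using False by (simp add: g_def)
  qed
  ultimately show ?thesis
    using s t unfolding asymp_equiv_rel_def by blast
qed

lemma asymp_equiv_refl:
  "s \<in> topspace (left_seqs k) \<Longrightarrow> (s, s) \<in> asymp_equiv_rel k (Hc k)"
  unfolding asymp_equiv_rel_def by (auto intro!: exI[of _ "\<lambda>_. id"] simp: id_in_Hc image_constant_conv)


section \<open>The maps of a regular simplex in barycentric coordinates\<close>

definition barycentric_comb :: "nat \<Rightarrow> (nat \<Rightarrow> 'a::real_vector) \<Rightarrow> (nat \<Rightarrow> real) \<Rightarrow> 'a"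
  where "barycentric_comb k p c = (\<Sum>j<k. c j *\<^sub>R p j)"

lemma affine_map_barycentric_comb:
  assumes "affine_map f" and "(\<Sum>j<k. c j) = 1"
  shows "f (barycentric_comb k p c) = barycentric_comb k (\<lambda>j. f (p j)) c"
proof -
  obtain L b where L: "linear L" and f: "f = (\<lambda>x. L x + b)"
    using assms(1) by (auto simp: affine_map_def)
  have "f (barycentric_comb k p c) = (\<Sum>j<k. c j *\<^sub>R L (p j)) + (\<Sum>j<k. c j) *\<^sub>R b"
    using assms(2) by (simp add: f barycentric_comb_def linear_sum[OF L] linear_scale[OF L])
  then show ?thesis
    by (simp add: f barycentric_comb_def scaleR_sum_left scaleR_add_right sum.distrib)
qed

text \<open>Affine independence says that the vectors \<open>p j - p 0\<close> are linearly independent, so a linear map can be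
prescribed on them.\<close>
lemma affine_map_with_vertex_images:
  fixes p v :: "nat \<Rightarrow> 'a::euclidean_space"
  assumes inj: "inj_on p {..<k}" and indep: "\<not> affine_dependent (p ` {..<k})"
  shows "\<exists>f. affine_map f \<and> (\<forall>j<k. f (p j) = v j)"
proof (cases "k = 0")
  case True
  have "affine_map (\<lambda>x::'a. x + 0)"
    unfolding affine_map_def using linear_id[unfolded id_def] by blast
  then show ?thesis
    using True by blast
next
  case False
  then have p0: "p 0 \<in> p ` {..<k}"
    by simp
  have "independent ((\<lambda>x. - p 0 + x) ` (p ` {..<k} - {p 0}))"
    using indep affine_dependent_iff_dependent2[OF p0] by simp
  then obtain L where L: "linear L"
      "\<And>x. x \<in> (\<lambda>x. - p 0 + x) ` (p ` {..<k} - {p 0}) \<Longrightarrow>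
        L x = v (the_inv_into {..<k} p (p 0 + x)) - v 0"
    using linear_independent_extend[of _ "\<lambda>x. v (the_inv_into {..<k} p (p 0 + x)) - v 0"] by blast
  let ?f = "\<lambda>x. L x + (v 0 - L (p 0))"
  have "?f (p j) = v j" if "j < k" for j
  proof (cases "p j = p 0")
    case True
    then have "j = 0"
      using inj that False by (auto dest: inj_onD)
    then show ?thesis
      by simp
  next
    case ne: False
    then have "L (- p 0 + p j) = v (the_inv_into {..<k} p (p j)) - v 0"
      using L(2)[of "- p 0 + p j"] that by auto
    then have "L (p j) - L (p 0) = v j - v 0"
      using that inj by (simp add: the_inv_into_f_f linear_diff[OF L(1)])
    then show ?thesis
      by (simp add: algebra_simps)
  qed
  moreover have "affine_map ?f"
    using L(1) by (auto simp: affine_map_def)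
  ultimately show ?thesis
    by blast
qed

locale regular_simplex =
  fixes k :: nat and p :: "nat \<Rightarrow> 'a::euclidean_space"
  assumes k_ge_3: "3 \<le> k" and dim: "DIM('a) = k - 1"
    and regular: "regular_simplex_vertices k p"
begin

abbreviation point :: "(nat \<Rightarrow> real) \<Rightarrow> 'a"
  where "point \<equiv> barycentric_comb k p"

abbreviation F :: "nat \<Rightarrow> 'a \<Rightarrow> 'a"
  where "F \<equiv> simplex_map k p"

definition side :: real
  where "side = dist (p 0) (p 1)"

lemma inj_vertices: "inj_on p {..<k}"
  using regular by (simp add: regular_simplex_vertices_def)

lemma affine_independent_vertices: "\<not> affine_dependent (p ` {..<k})"
  using regular by (simp add: regular_simplex_vertices_def)

lemma dist_vertices: "i < k \<Longrightarrow> j < k \<Longrightarrow> dist (p i) (p j) = (if i = j then 0 else side)"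
proof -
  obtain s where s: "\<And>i j. i < k \<Longrightarrow> j < k \<Longrightarrow> i \<noteq> j \<Longrightarrow> dist (p i) (p j) = s"
    using regular by (auto simp: regular_simplex_vertices_def)
  have "side = s"
    using s[of 0 1] k_ge_3 by (simp add: side_def)
  then show "i < k \<Longrightarrow> j < k \<Longrightarrow> dist (p i) (p j) = (if i = j then 0 else side)"
    using s by simp
qed

lemma side_pos: "0 < side"
  using inj_onD[OF inj_vertices, of 0 1] k_ge_3 by (auto simp: side_def)

text \<open>Polarisation expresses \<open>p i \<bullet> p j\<close> through norms and the distances between the vertices. The norms
cancel since the coefficients add up to \<open>0\<close>, and all the distances are equal. So the Euclidean
metric is, up to a factor, the Euclidean metric of the barycentric coordinates.\<close>
lemma norm_point_diff:
  assumes d: "(\<Sum>j<k. d j) = 0"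
  shows "(norm (point d))\<^sup>2 = side\<^sup>2 / 2 * (\<Sum>j<k. (d j)\<^sup>2)"
proof -
  have polar: "2 * (p i \<bullet> p j) = (norm (p i))\<^sup>2 + (norm (p j))\<^sup>2 - (dist (p i) (p j))\<^sup>2" for i j
    by (simp add: dist_norm power2_norm_eq_inner inner_diff_left inner_diff_right inner_commute)
  have "2 * (norm (point d))\<^sup>2 = (\<Sum>i<k. \<Sum>j<k. d i * d j * (2 * (p i \<bullet> p j)))"
    by (simp add: barycentric_comb_def power2_norm_eq_inner inner_sum_left inner_sum_right
        sum_distrib_left mult_ac) (simp add: inner_commute)
  also have "\<dots> = (\<Sum>i<k. \<Sum>j<k. (d i * (norm (p i))\<^sup>2) * d j) + (\<Sum>i<k. \<Sum>j<k. d i * (d j * (norm (p j))\<^sup>2))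
      - (\<Sum>i<k. \<Sum>j<k. d i * d j * (dist (p i) (p j))\<^sup>2)"
    by (simp add: polar algebra_simps sum.distrib sum_subtractf)
  also have "(\<Sum>i<k. \<Sum>j<k. (d i * (norm (p i))\<^sup>2) * d j) = 0"
    by (simp add: d flip: sum_distrib_left)
  also have "(\<Sum>i<k. \<Sum>j<k. d i * (d j * (norm (p j))\<^sup>2)) = 0"
    by (simp add: d flip: sum_distrib_left sum_distrib_right)
  also have "(\<Sum>i<k. \<Sum>j<k. d i * d j * (dist (p i) (p j))\<^sup>2)
      = (\<Sum>i<k. \<Sum>j<k. side\<^sup>2 * (d i * d j - (if j = i then (d i)\<^sup>2 else 0)))"
    by (intro sum.cong refl) (auto simp: dist_vertices power2_eq_square)
  also have "\<dots> = side\<^sup>2 * ((\<Sum>i<k. d i * (\<Sum>j<k. d j)) - (\<Sum>i<k. (d i)\<^sup>2))"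
    by (simp add: sum_subtractf sum_distrib_left right_diff_distrib
        if_distrib[of "\<lambda>z. side\<^sup>2 * z"] cong: if_cong)
  finally show ?thesis
    using d by simp
qed

lemma ex_barycentric: "\<exists>c. (\<Sum>j<k. c j) = 1 \<and> point c = x"
proof -
  have "card (p ` {..<k}) = Suc DIM('a)"
    using dim k_ge_3 by (simp add: card_image[OF inj_vertices])
  then have "x \<in> affine hull (p ` {..<k})"
    using affine_independent_span_eq[OF affine_independent_vertices] by simp
  then obtain u where "sum u (p ` {..<k}) = 1" "(\<Sum>v\<in>p ` {..<k}. u v *\<^sub>R v) = x"
    by (auto simp: affine_hull_finite)
  then have "(\<Sum>j<k. u (p j)) = 1 \<and> point (\<lambda>j. u (p j)) = x"
    by (simp add: barycentric_comb_def sum.reindex[OF inj_vertices])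
  then show ?thesis
    by blast
qed

definition bary :: "'a \<Rightarrow> nat \<Rightarrow> real"
  where "bary x = (SOME c. (\<Sum>j<k. c j) = 1 \<and> point c = x)"

lemma sum_bary: "(\<Sum>j<k. bary x j) = 1" and point_bary: "point (bary x) = x"
  using someI_ex[OF ex_barycentric[of x]] by (simp_all add: bary_def)

lemma dist_eq_bary: "(dist x y)\<^sup>2 = side\<^sup>2 / 2 * (\<Sum>j<k. (bary x j - bary y j)\<^sup>2)"
proof -
  have "x - y = point (\<lambda>j. bary x j - bary y j)"
    using point_bary[of x] point_bary[of y]
    by (simp add: barycentric_comb_def scaleR_diff_left sum_subtractf)
  then show ?thesis
    using norm_point_diff[of "\<lambda>j. bary x j - bary y j"]
    by (simp add: dist_norm sum_subtractf sum_bary)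
qed

lemma bary_unique:
  assumes c: "(\<Sum>j<k. c j) = 1" and j: "j < k"
  shows "bary (point c) j = c j"
proof -
  let ?d = "\<lambda>j. bary (point c) j - c j"
  have "point ?d = 0"
    using point_bary[of "point c"]
    by (simp add: barycentric_comb_def scaleR_diff_left sum_subtractf)
  then have "(\<Sum>j<k. (?d j)\<^sup>2) = 0"
    using norm_point_diff[of ?d] side_pos by (simp add: sum_subtractf sum_bary c)
  then show ?thesis
    using j by (simp add: sum_nonneg_eq_0_iff)
qed

lemma bary_eqI: "(\<And>j. j < k \<Longrightarrow> bary x j = bary y j) \<Longrightarrow> x = y"
  using point_bary[of x] point_bary[of y] by (simp add: barycentric_comb_def)

lemma bary_vertex: "i < k \<Longrightarrow> j < k \<Longrightarrow> bary (p i) j = (if j = i then 1 else 0)"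
  using bary_unique[of "\<lambda>j. if j = i then 1 else 0" j]
  by (simp add: barycentric_comb_def if_distrib[of "\<lambda>c. c *\<^sub>R _"] cong: if_cong)

lemma continuous_on_bary:
  assumes j: "j < k"
  shows "continuous_on UNIV (\<lambda>x. bary x j)"
proof -
  have bound: "\<bar>bary x j - bary y j\<bar> \<le> 2 / side * dist x y" for x y
  proof -
    have "(bary x j - bary y j)\<^sup>2 \<le> (\<Sum>j<k. (bary x j - bary y j)\<^sup>2)"
      using j by (intro member_le_sum) auto
    then have "side\<^sup>2 / 2 * (bary x j - bary y j)\<^sup>2 \<le> (dist x y)\<^sup>2"
      unfolding dist_eq_bary by (intro mult_left_mono) auto
    moreover have "0 \<le> (dist x y)\<^sup>2" "(2 * dist x y)\<^sup>2 = 4 * (dist x y)\<^sup>2"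
      "(side * \<bar>bary x j - bary y j\<bar>)\<^sup>2 = side\<^sup>2 * (bary x j - bary y j)\<^sup>2"
      by (simp_all add: power_mult_distrib)
    ultimately have "(side * \<bar>bary x j - bary y j\<bar>)\<^sup>2 \<le> (2 * dist x y)\<^sup>2"
      by linarith
    then have "side * \<bar>bary x j - bary y j\<bar> \<le> 2 * dist x y"
      by (rule power2_le_imp_le) simp
    then show ?thesis
      using side_pos by (simp add: field_simps)
  qed
  have "(2 / side)-lipschitz_on UNIV (\<lambda>x. bary x j)"
    using side_pos bound by (intro lipschitz_onI) (auto simp: dist_real_def)
  then show ?thesis
    by (rule lipschitz_on_continuous_on)
qed

lemma simplex_map_affine:
  assumes i: "i < k"
  shows "affine_map (F i)" and "F i (p i) = p i"
    and "\<And>j. j < k \<Longrightarrow> j \<noteq> i \<Longrightarrow> F i (p j) = facet_centre k p j"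
proof -
  let ?P = "\<lambda>f. affine_map f \<and> f (p i) = p i \<and> (\<forall>j<k. j \<noteq> i \<longrightarrow> f (p j) = facet_centre k p j)"
  have "\<exists>!f. ?P f"
  proof (rule ex_ex1I)
    show "\<exists>f. ?P f"
      using affine_map_with_vertex_images[OF inj_vertices affine_independent_vertices,
          of "\<lambda>j. if j = i then p i else facet_centre k p j"] i by force
    fix f g assume fg: "?P f" "?P g"
    then have vertices: "f (p j) = g (p j)" if "j < k" for j
      using that by (cases "j = i") auto
    show "f = g"
    proof
      fix x
      have "f (point (bary x)) = barycentric_comb k (\<lambda>j. f (p j)) (bary x)"
        using fg by (intro affine_map_barycentric_comb sum_bary) blast
      also have "\<dots> = barycentric_comb k (\<lambda>j. g (p j)) (bary x)"
        by (simp add: barycentric_comb_def vertices)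
      also have "\<dots> = g (point (bary x))"
        using fg by (intro affine_map_barycentric_comb[symmetric] sum_bary) blast
      finally have "f (point (bary x)) = g (point (bary x))" .
      then show "f x = g x"
        by (simp add: point_bary)
    qed
  qed
  then have "?P (F i)"
    unfolding simplex_map_def by (rule theI')
  then show "affine_map (F i)" "F i (p i) = p i"
    "\<And>j. j < k \<Longrightarrow> j \<noteq> i \<Longrightarrow> F i (p j) = facet_centre k p j"
    by blast+
qed

lemma facet_centre_eq:
  assumes "j < k"
  shows "facet_centre k p j = point (\<lambda>l. if l = j then 0 else 1 / (real k - 1))"
proof -
  have "point (\<lambda>l. if l = j then 0 else 1 / (real k - 1))
      = (\<Sum>l\<in>{..<k} - {j}. (1 / (real k - 1)) *\<^sub>R p l)"
    unfolding barycentric_comb_def by (intro sum.mono_neutral_cong_right) auto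
  then show ?thesis
    by (simp add: facet_centre_def scaleR_sum_right)
qed

text \<open>The point \<open>F i x\<close> is the combination of the images \<open>F i (p n)\<close> with the coordinates of \<open>x\<close> as weights,
and these images are \<open>p i\<close> itself and facet centres.\<close>
lemma bary_simplex_map:
  assumes i: "i < k" and j: "j < k"
  shows "bary (F i x) j = (if j = i then 1 + (real k - 2) * bary x i
    else 1 - bary x i - bary x j) / (real k - 1)"
proof -
  define c where "c = bary x"
  define m where "m = 1 / (real k - 1)"
  \<comment> \<open>\<open>v n\<close> is the coordinate vector of \<open>F i (p n)\<close>.\<close>
  define v where "v = (\<lambda>n l. if n = i then (if l = i then 1 else 0) else if l = n then 0 else m)"
  have m: "(real k - 1) * m = 1"
    using k_ge_3 by (simp add: m_def)
  have c1: "(\<Sum>n<k. c n) = 1"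
    by (simp add: c_def sum_bary)
  have "F i x = barycentric_comb k (\<lambda>n. F i (p n)) c"
    using affine_map_barycentric_comb[OF simplex_map_affine(1)[OF i] sum_bary, of p x]
    by (simp add: point_bary c_def)
  also have "\<dots> = (\<Sum>n<k. c n *\<^sub>R point (v n))"
    unfolding barycentric_comb_def
  proof (rule sum.cong[OF refl])
    fix n assume n: "n \<in> {..<k}"
    have "F i (p n) = point (v n)"
    proof (cases "n = i")
      case True
      then have "point (v n) = (\<Sum>l<k. if l = i then p l else 0)"
        unfolding barycentric_comb_def v_def by (intro sum.cong) auto
      then show ?thesis
        using True i by (simp add: simplex_map_affine(2))
    next
      case False
      then show ?thesis
        using n i unfolding v_def m_def by (simp add: simplex_map_affine(3) facet_centre_eq)
    qed
    then show "c n *\<^sub>R F i (p n) = c n *\<^sub>R (\<Sum>l<k. v n l *\<^sub>R p l)"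
      by (simp add: barycentric_comb_def)
  qed
  also have "\<dots> = point (\<lambda>l. \<Sum>n<k. c n * v n l)"
    unfolding barycentric_comb_def scaleR_sum_right scaleR_sum_left
    by (subst sum.swap) simp
  finally have Fx: "F i x = point (\<lambda>l. \<Sum>n<k. c n * v n l)" .
  have coord: "(\<Sum>n<k. c n * v n l) = (if l = i then 1 + (real k - 2) * c i else 1 - c i - c l) * m"
    if l: "l < k" for l
  proof -
    have "(\<Sum>n<k. c n * v n l) = (\<Sum>n<k. m * c n + (if n = i then (if l = i then 1 - m else - m) * c n else 0)
        + (if n = l then (if l = i then 0 else - m) * c n else 0))"
      by (intro sum.cong refl) (auto simp: v_def algebra_simps)
    also have "\<dots> = m + (if l = i then 1 - m else - m) * c i + (if l = i then 0 else - m) * c l"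
      using i l by (simp add: sum.distrib c1 flip: sum_distrib_left)
    also have "\<dots> = (if l = i then 1 + (real k - 2) * c i else 1 - c i - c l) * m"
    proof (cases "l = i")
      case True
      have "(1 + (real k - 2) * c i) * m = m + ((real k - 1) * m) * c i - m * c i"
        by (simp add: algebra_simps)
      also have "\<dots> = m + 1 * c i - m * c i"
        by (simp only: m)
      finally show ?thesis
        using True by (simp add: left_diff_distrib)
    qed (simp add: algebra_simps)
    finally show ?thesis .
  qed
  have "(\<Sum>l<k. \<Sum>n<k. c n * v n l) = (\<Sum>n<k. c n * (\<Sum>l<k. v n l))"
    unfolding sum_distrib_left by (rule sum.swap)
  also have "\<dots> = (\<Sum>n<k. c n)"
  proof (rule sum.cong[OF refl])
    fix n assume n: "n \<in> {..<k}"
    have "(\<Sum>l<k. v n l) = 1"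
    proof (cases "n = i")
      case False
      then have "(\<Sum>l<k. v n l) = (\<Sum>l<k. m - (if l = n then m else 0))"
        unfolding v_def by (intro sum.cong) auto
      also have "\<dots> = (real k - 1) * m"
        using n by (simp add: sum_subtractf algebra_simps)
      finally show ?thesis
        by (simp add: m)
    qed (use i in \<open>simp add: v_def\<close>)
    then show "c n * (\<Sum>l<k. v n l) = c n"
      by simp
  qed
  finally have "(\<Sum>l<k. \<Sum>n<k. c n * v n l) = 1"
    by (simp add: c1)
  then have "bary (F i x) j = (\<Sum>n<k. c n * v n j)"
    unfolding Fx using j by (rule bary_unique)
  then show ?thesis
    using coord[OF j] by (simp add: c_def m_def)
qed

lemma bary_simplex_map_scaled:
  assumes "i < k" "j < k"
  shows "(real k - 1) * bary (F i x) j
    = (if j = i then 1 + (real k - 2) * bary x i else 1 - bary x i - bary x j)"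
  using assms k_ge_3 by (simp add: bary_simplex_map)

text \<open>If \<open>d\<close> is the difference of the coordinates of two points, then the squared length of
\<open>(k - 1) * d'\<close>, where \<open>d'\<close> belongs to their images under \<open>F i\<close>, is \<open>(k\<^sup>2 - 3 * k + 1) * (d i)\<^sup>2\<close> plus the sum of
the other \<open>(d j)\<^sup>2\<close>. The first factor is at least \<open>1\<close> for \<open>k \<ge> 3\<close>, hence this ratio.\<close>
definition ratio :: real
  where "ratio = sqrt ((real k)\<^sup>2 - 3 * real k + 1) / (real k - 1)"

lemma ratio_radicand_ge_1: "1 \<le> (real k)\<^sup>2 - 3 * real k + 1"
proof -
  have "0 \<le> real k * (real k - 3)"
    using k_ge_3 by simp
  then show ?thesis
    by (simp add: power2_eq_square algebra_simps)
qed

lemma ratio_bounds: "0 \<le> ratio" "ratio < 1"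
proof -
  show "0 \<le> ratio"
    using ratio_radicand_ge_1 k_ge_3 by (simp add: ratio_def)
  have "sqrt ((real k)\<^sup>2 - 3 * real k + 1) < sqrt ((real k - 1)\<^sup>2)"
    using k_ge_3 by (intro real_sqrt_less_mono) (simp add: power2_eq_square algebra_simps)
  then show "ratio < 1"
    using k_ge_3 by (simp add: ratio_def)
qed

lemma dist_simplex_map_le:
  assumes i: "i < k"
  shows "dist (F i x) (F i y) \<le> ratio * dist x y"
proof -
  define d where "d = (\<lambda>j. bary x j - bary y j)"
  define e where "e = (\<lambda>j. bary (F i x) j - bary (F i y) j)"
  let ?R = "\<Sum>j\<in>{..<k} - {i}. (d j)\<^sup>2"
  let ?N = "(real k)\<^sup>2 - 3 * real k + 1"
  have k1: "0 < real k - 1"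
    using k_ge_3 by simp
  have split: "(\<Sum>j<k. g j) = g i + (\<Sum>j\<in>{..<k} - {i}. g j)" for g :: "nat \<Rightarrow> real"
    using i by (simp add: sum.remove)
  have "(\<Sum>j<k. d j) = 0"
    by (simp add: d_def sum_subtractf sum_bary)
  then have rest: "(\<Sum>j\<in>{..<k} - {i}. d j) = - d i"
    using split[of d] by simp
  have ei: "(real k - 1) * e i = (real k - 2) * d i"
    unfolding e_def d_def right_diff_distrib[of "real k - 1"] bary_simplex_map_scaled[OF i i]
    by (simp add: algebra_simps)
  have ej: "(real k - 1) * e j = - (d i + d j)" if "j \<in> {..<k} - {i}" for j
    using i that by (simp add: e_def d_def right_diff_distrib[of "real k - 1"] bary_simplex_map_scaled)
  have "(\<Sum>j<k. ((real k - 1) * e j)\<^sup>2) = ((real k - 2) * d i)\<^sup>2 + (\<Sum>j\<in>{..<k} - {i}. (d i + d j)\<^sup>2)"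
    unfolding split[of "\<lambda>j. ((real k - 1) * e j)\<^sup>2"] ei by (simp only: ej power2_minus cong: sum.cong)
  also have "(\<Sum>j\<in>{..<k} - {i}. (d i + d j)\<^sup>2) = (real k - 1) * (d i)\<^sup>2 + 2 * d i * (- d i) + ?R"
    using i k_ge_3 rest
    by (simp add: power2_sum sum.distrib of_nat_diff flip: sum_distrib_left)
  also have "((real k - 2) * d i)\<^sup>2 + ((real k - 1) * (d i)\<^sup>2 + 2 * d i * (- d i) + ?R) = ?N * (d i)\<^sup>2 + ?R"
    by (simp add: power2_eq_square algebra_simps)
  also have "\<dots> \<le> ?N * (d i)\<^sup>2 + ?N * ?R"
    using mult_right_mono[OF ratio_radicand_ge_1, of ?R] by (simp add: sum_nonneg)
  also have "\<dots> = ?N * (\<Sum>j<k. (d j)\<^sup>2)"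
    unfolding split[of "\<lambda>j. (d j)\<^sup>2"] by (simp add: distrib_left)
  finally have "(real k - 1)\<^sup>2 * (\<Sum>j<k. (e j)\<^sup>2) \<le> ?N * (\<Sum>j<k. (d j)\<^sup>2)"
    by (simp only: power_mult_distrib sum_distrib_left)
  then have "(\<Sum>j<k. (e j)\<^sup>2) \<le> ?N / (real k - 1)\<^sup>2 * (\<Sum>j<k. (d j)\<^sup>2)"
    using k1 by (simp add: pos_le_divide_eq mult.commute)
  moreover have "ratio\<^sup>2 = ?N / (real k - 1)\<^sup>2"
    using ratio_radicand_ge_1 by (simp add: ratio_def power_divide)
  ultimately have "(\<Sum>j<k. (e j)\<^sup>2) \<le> ratio\<^sup>2 * (\<Sum>j<k. (d j)\<^sup>2)"
    by (simp only:)
  then have "side\<^sup>2 / 2 * (\<Sum>j<k. (e j)\<^sup>2) \<le> side\<^sup>2 / 2 * (ratio\<^sup>2 * (\<Sum>j<k. (d j)\<^sup>2))"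
    by (rule mult_left_mono) simp
  then have "(dist (F i x) (F i y))\<^sup>2 \<le> (ratio * dist x y)\<^sup>2"
    by (simp add: dist_eq_bary power_mult_distrib d_def e_def mult_ac)
  then show ?thesis
    by (rule power2_le_imp_le) (simp add: ratio_bounds)
qed


section \<open>Coincidences of the coding map\<close>

sublocale contracting_ifs k F ratio
  using k_ge_3 ratio_bounds dist_simplex_map_le by unfold_locales auto

lemma self_similar_set_eq: "self_similar_set k p = coding ` topspace (left_seqs k)"
  unfolding self_similar_set_def by (rule the_self_similar_set)

definition full_simplex :: "'a set"
  where "full_simplex = {x. \<forall>j<k. 0 \<le> bary x j}"

lemma sum_bary_le_1:
  assumes "x \<in> full_simplex" "A \<subseteq> {..<k}"
  shows "(\<Sum>j\<in>A. bary x j) \<le> 1"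
  using sum_mono2[OF finite_lessThan assms(2), of "bary x"] assms(1)
  by (auto simp: full_simplex_def sum_bary)

lemma vertex_in_full_simplex: "i < k \<Longrightarrow> p i \<in> full_simplex"
  by (simp add: full_simplex_def bary_vertex)

lemma closed_full_simplex: "closed full_simplex"
proof -
  have "full_simplex = (\<Inter>j\<in>{..<k}. {x. 0 \<le> bary x j})"
    by (auto simp: full_simplex_def)
  moreover have "closed {x. 0 \<le> bary x j}" if "j < k" for j
    using continuous_on_bary[OF that] by (intro closed_Collect_le) auto
  ultimately show ?thesis
    by auto
qed

lemma simplex_map_in_full_simplex:
  assumes "i < k" "x \<in> full_simplex"
  shows "F i x \<in> full_simplex"
proof -
  have "bary x i + bary x j \<le> 1" if "j < k" "j \<noteq> i" for j
    using sum_bary_le_1[OF assms(2), of "{i, j}"] that assms(1) by simp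
  then have "0 \<le> 1 - bary x i - bary x j" if "j < k" "j \<noteq> i" for j
    using that by fastforce
  moreover have "0 \<le> 1 + (real k - 2) * bary x i"
    using assms k_ge_3 by (simp add: full_simplex_def)
  ultimately show ?thesis
    using assms k_ge_3 by (simp add: full_simplex_def bary_simplex_map)
qed

lemma coding_in_full_simplex: "s \<in> topspace (left_seqs k) \<Longrightarrow> coding s \<in> full_simplex"
  using coding_in_closed[OF _ closed_full_simplex] simplex_map_in_full_simplex vertex_in_full_simplex[of 0] k_ge_3
  by force

lemma inj_simplex_map:
  assumes i: "i < k" and eq: "F i x = F i y"
  shows "x = y"
proof (rule bary_eqI)
  have eqs: "bary (F i x) j = bary (F i y) j" for j
    by (simp add: eq)
  have xi: "bary x i = bary y i"
    using eqs[of i] i k_ge_3 by (simp add: bary_simplex_map)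
  show "bary x j = bary y j" if "j < k" for j
    using eqs[of j] xi i that k_ge_3 by (cases "j = i") (simp_all add: bary_simplex_map)
qed

text \<open>Comparing the coordinates \<open>i\<close> and \<open>j\<close> of the common image gives two sums of nonnegative terms that
vanish; after that the remaining coordinates of \<open>x\<close> and \<open>y\<close> agree one by one.\<close>
lemma simplex_map_overlap:
  assumes ij: "i < k" "j < k" "i \<noteq> j" and xy: "x \<in> full_simplex" "y \<in> full_simplex" and eq: "F i x = F j y"
  shows "x = y" and "bary x i = 0" and "bary x j = 0"
proof -
  have k: "real k - 1 > 0" "real k - 2 > 0"
    using k_ge_3 by simp_all
  have eqs: "bary (F i x) l * (real k - 1) = bary (F j y) l * (real k - 1)" for l
    by (simp add: eq)
  have "(real k - 2) * bary x i + bary y i + bary y j = 0"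
    "(real k - 2) * bary y j + bary x i + bary x j = 0"
    using eqs[of i] eqs[of j] ij k by (simp_all add: bary_simplex_map)
  moreover have "0 \<le> bary x i" "0 \<le> bary x j" "0 \<le> bary y i" "0 \<le> bary y j"
    using xy ij by (simp_all add: full_simplex_def)
  moreover from this have "0 \<le> (real k - 2) * bary x i" "0 \<le> (real k - 2) * bary y j"
    using k by simp_all
  ultimately have zero: "bary x i = 0" "bary x j = 0" "bary y i = 0" "bary y j = 0"
    by linarith+
  then show "bary x i = 0" "bary x j = 0"
    by simp_all
  show "x = y"
  proof (rule bary_eqI)
    show "bary x l = bary y l" if "l < k" for l
      using eqs[of l] ij that zero k by (cases "l = i \<or> l = j") (auto simp: bary_simplex_map)
  qed
qed

lemma eq_vertexI:
  assumes x: "x \<in> full_simplex" and l: "l < k" "bary x l = 1"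
  shows "x = p l"
proof (rule bary_eqI)
  fix j assume j: "j < k"
  show "bary x j = bary (p l) j"
    using sum_bary_le_1[OF x, of "{l, j}"] x j l by (cases "j = l") (auto simp: bary_vertex full_simplex_def)
qed

text \<open>This excludes the last letter of a sequence from the vanishing coordinates of its code.\<close>
lemma bary_simplex_map_self_pos:
  assumes "i < k" "x \<in> full_simplex"
  shows "0 < bary (F i x) i"
proof -
  have "0 \<le> (real k - 2) * bary x i"
    using assms k_ge_3 by (simp add: full_simplex_def)
  then show ?thesis
    using assms k_ge_3 by (simp add: bary_simplex_map)
qed

lemma coding_eq_vertex:
  assumes "s \<in> topspace (left_seqs k)" "l < k" "coding s = p l"
  shows "s n = l"
  using assms
proof (induction n arbitrary: s)
  have first_letter: "s 0 = l"
    if s: "s \<in> topspace (left_seqs k)" "l < k" "coding s = p l" for s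
  proof -
    have "0 < bary (p l) (s 0)"
      using bary_simplex_map_self_pos[of "s 0"] coding_unfold[OF s(1)] s
        coding_in_full_simplex[OF shift_in_left_seqs(2)[OF s(1)]] by (simp add: topspace_left_seqs)
    then show ?thesis
      using s by (simp add: bary_vertex topspace_left_seqs split: if_splits)
  qed
  {
    case 0
    then show ?case
      by (rule first_letter)
  next
    case (Suc n)
    let ?t = "\<lambda>m. s (Suc m)"
    have "p l = F l (coding ?t)"
      using coding_unfold[OF Suc.prems(1)] first_letter[OF Suc.prems] Suc.prems(3) by metis
    then have "F l (coding ?t) = F l (p l)"
      using simplex_map_affine(2)[OF Suc.prems(2)] by metis
    then have "coding ?t = p l"
      using inj_simplex_map Suc.prems(2) by blast
    then show ?case
      using Suc.IH[OF shift_in_left_seqs(2)[OF Suc.prems(1)] Suc.prems(2)] by simp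
  }
qed

text \<open>The last letter \<open>l\<close> of \<open>s\<close> differs from \<open>i\<close> and \<open>j\<close>. The vanishing of the coordinates \<open>i\<close> and \<open>j\<close> of
the point \<open>F l z\<close>, where \<open>z\<close> is the code of the letters before \<open>l\<close>, says that \<open>bary z l + bary z i\<close> and
\<open>bary z l + bary z j\<close> are both \<open>1\<close>. Since the coordinates of \<open>z\<close> are nonnegative with sum \<open>1\<close>, this
forces \<open>bary z l = 1\<close>.\<close>
lemma coding_on_small_face:
  assumes s: "s \<in> topspace (left_seqs k)" and ij: "i < k" "j < k" "i \<noteq> j"
    and zero: "bary (coding s) i = 0" "bary (coding s) j = 0"
  obtains l where "l < k" "l \<noteq> i" "l \<noteq> j" "coding s = p l"
proof -
  define l where "l = s 0"
  define z where "z = coding (\<lambda>m. s (Suc m))"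
  have l: "l < k"
    using s by (simp add: l_def topspace_left_seqs)
  have z: "z \<in> full_simplex"
    unfolding z_def using s by (intro coding_in_full_simplex shift_in_left_seqs)
  have s_eq: "coding s = F l z"
    unfolding l_def z_def by (rule coding_unfold[OF s])
  have ne: "l \<noteq> i" "l \<noteq> j"
    using bary_simplex_map_self_pos[OF l z] zero s_eq by auto
  have "bary z l + bary z i = 1" "bary z l + bary z j = 1"
    using zero ne ij l k_ge_3 by (simp_all add: s_eq bary_simplex_map)
  moreover have "bary z l + bary z i + bary z j \<le> 1"
    using sum_bary_le_1[OF z, of "{l, i, j}"] ne ij l by simp
  moreover have "0 \<le> bary z i" "0 \<le> bary z j"
    using z ij by (simp_all add: full_simplex_def)
  ultimately have "bary z l = 1"
    by linarith
  then have "coding s = p l"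
    using eq_vertexI[OF z l] s_eq simplex_map_affine(2)[OF l] by simp
  with l ne show thesis
    by (rule that)
qed

lemma inj_fold_simplex_map:
  "u \<in> words k \<Longrightarrow> fold F u x = fold F u y \<Longrightarrow> x = y"
  by (induction u arbitrary: x y) (auto dest: inj_simplex_map)

text \<open>Cancel the common end of the two sequences with the injectivity of the maps \<open>F\<close>. At the first difference
two images of the simplex under different maps meet, so the rest of both sequences codes the same
vertex.\<close>
lemma coding_eq_imp_asymp_equiv:
  assumes s: "s \<in> topspace (left_seqs k)" and t: "t \<in> topspace (left_seqs k)"
    and eq: "coding s = coding t"
  shows "(s, t) \<in> asymp_equiv_rel k (Hc k)"
proof (cases "s = t")
  case True
  then show ?thesis
    using s by (simp add: asymp_equiv_refl)
next
  case False
  define m where "m = (LEAST m. s m \<noteq> t m)"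
  obtain n where "s n \<noteq> t n"
    using False by blast
  then have ne: "s m \<noteq> t m"
    unfolding m_def by (rule LeastI)
  have common: "s n = t n" if "n < m" for n
    using not_less_Least[of n "\<lambda>m. s m \<noteq> t m"] that by (auto simp: m_def)
  let ?s = "\<lambda>n. s (n + Suc m)" and ?t = "\<lambda>n. t (n + Suc m)"
  have letters: "s m < k" "t m < k"
    using s t by (simp_all add: topspace_left_seqs)
  have shifts: "?s \<in> topspace (left_seqs k)" "?t \<in> topspace (left_seqs k)"
    using shift_in_left_seqs(1)[OF s] shift_in_left_seqs(1)[OF t] by blast+
  have "left_word s m = left_word t m"
    using common by (rule left_word_cong)
  then have "fold F (left_word s m) (F (s m) (coding ?s)) = fold F (left_word s m) (F (t m) (coding ?t))"
    using eq coding_eq_fold[OF s, of "Suc m"] coding_eq_fold[OF t, of "Suc m"]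
    by (simp add: left_word_Suc)
  then have "F (s m) (coding ?s) = F (t m) (coding ?t)"
    by (rule inj_fold_simplex_map[OF left_word_in_words[OF s]])
  note overlap = simplex_map_overlap[OF letters ne coding_in_full_simplex[OF shifts(1)]
      coding_in_full_simplex[OF shifts(2)] this]
  obtain l where l: "l < k" "l \<noteq> s m" "l \<noteq> t m" "coding ?s = p l"
    using coding_on_small_face[OF shifts(1) letters ne overlap(2,3)] .
  have l_t: "coding ?t = p l"
    by (rule trans[OF overlap(1)[symmetric] l(4)])
  show ?thesis
  proof (rule asymp_equiv_if_constant_tail[OF s t common _ _ l(1-3)])
    fix n assume "m < n"
    then have n: "n - Suc m + Suc m = n"
      by simp
    show "s n = l"
      using coding_eq_vertex[OF shifts(1) l(1,4), of "n - Suc m"] unfolding n .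
    show "t n = l"
      using coding_eq_vertex[OF shifts(2) l(1) l_t, of "n - Suc m"] unfolding n .
  qed
qed

lemma asymp_equiv_iff_coding_eq:
  assumes s: "s \<in> topspace (left_seqs k)" and t: "t \<in> topspace (left_seqs k)"
  shows "(s, t) \<in> asymp_equiv_rel k (Hc k) \<longleftrightarrow> coding s = coding t"
proof
  have opposite: "F i (p l) = F j (p l)" if "l < k" "i < k" "j < k" "i \<noteq> l" "j \<noteq> l" for l i j
    using that by (simp add: simplex_map_affine(3))
  assume "(s, t) \<in> asymp_equiv_rel k (Hc k)"
  then show "coding s = coding t"
    using simplex_map_affine(2) opposite by (rule asymp_equiv_imp_coding_eq)
qed (rule coding_eq_imp_asymp_equiv[OF s t])

lemma asymp_equiv_class:
  assumes s: "s \<in> topspace (left_seqs k)"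
  shows "asymp_equiv_rel k (Hc k) `` {s} = {t \<in> topspace (left_seqs k). coding s = coding t}"
proof (rule Set.set_eqI)
  fix t
  have "t \<in> topspace (left_seqs k)" if "(s, t) \<in> asymp_equiv_rel k (Hc k)"
    using that by (simp add: asymp_equiv_rel_def)
  then show "t \<in> asymp_equiv_rel k (Hc k) `` {s} \<longleftrightarrow>
      t \<in> {t \<in> topspace (left_seqs k). coding s = coding t}"
    unfolding Image_singleton_iff mem_Collect_eq using asymp_equiv_iff_coding_eq[OF s] by metis
qed

theorem self_similar_set_homeomorphic_limit_space:
  "top_of_set (self_similar_set k p) homeomorphic_space limit_space k (Hc k)"
  unfolding self_similar_set_eq limit_space_def
proof (rule homeomorphic_space_quotients_same_kernel[OF quotient_map_coding quotient_map_quotient_topology])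
  fix s t assume s: "s \<in> topspace (left_seqs k)" and t: "t \<in> topspace (left_seqs k)"
  show "coding s = coding t \<longleftrightarrow>
      asymp_equiv_rel k (Hc k) `` {s} = asymp_equiv_rel k (Hc k) `` {t}"
  proof
    assume "coding s = coding t"
    then show "asymp_equiv_rel k (Hc k) `` {s} = asymp_equiv_rel k (Hc k) `` {t}"
      by (simp only: asymp_equiv_class[OF s] asymp_equiv_class[OF t])
  next
    assume "asymp_equiv_rel k (Hc k) `` {s} = asymp_equiv_rel k (Hc k) `` {t}"
    then have "t \<in> {u \<in> topspace (left_seqs k). coding s = coding u}"
      unfolding asymp_equiv_class[OF s] asymp_equiv_class[OF t] using t by simp
    then show "coding s = coding t"
      by simp
  qed
qed

end

theorem proposition5p5:
  fixes k :: nat and p :: "nat \<Rightarrow> real ^ 'n"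
  assumes "k \<ge> 3" and "CARD('n) = k - 1" and "regular_simplex_vertices k p"
  shows "top_of_set (self_similar_set k p) homeomorphic_space limit_space k (Hc k)"
proof -
  interpret regular_simplex k p
    using assms by unfold_locales auto
  show ?thesis
    by (rule self_similar_set_homeomorphic_limit_space)
qed

end
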